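(* Let $A$ be a nonzero nilpotent algebra over a field $\mathbb{F}$, and let $r\le m$. Consider a system of polynomial equations with coefficients in $A$, $$f_1(x_1,\ldots,x_m)=0,\ \ldots,\ f_r(x_1,\ldots,x_m)=0,$$ whose $r\times m$ Jacobian matrix $J$ over $\mathbb{F}$ has maximal rank $r$. Then the solutions can be expressed as polynomial functions of $m-r$ free variables defined on the entire algebra $A$: one can split the variables into $r$ pivot variables $x_{i_1},\dots,x_{i_r}$ and $m-r$ free variables $x_{j_1},\dots,x_{j_{m-r}}$, and there are polynomial functions $h_1,\dots,h_r$ (with coefficients in $A$) of $m-r$ variables, such that $(x_1,\dots,x_m)\in A^m$ is a solution of the system if and only if $x_{i_s}=h_s(x_{j_1},\dots,x_{j_{m-r}})$ for $s=1,\dots,r$. Moreover, if $A$ has finite dimension $d$ over $\mathbb{F}$, then the set of solutions is an affine space of dimension $d(m-r)$, in the sense that it is the graph of a polynomial mapping defined on the whole $d(m-r)$-dimensional space $A^{m-r}$ (direct power).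
   Context: An algebra over $\mathbb{F}$ is a vector space with a bilinear multiplication, not assumed associative, Lie, commutative or unital. $A$ is nilpotent of class $\le c$ if every product (with any bracketing) of $c+1$ elements of $A$ is zero. Let $\mathcal{F}(X)$ be the absolutely free nonassociative (non-unital) algebra on $X=\{x_1,\dots,x_m\}$. A polynomial function with coefficients in $A$ is given by an element $f$ of the free product $\mathcal{F}(X)*A$ of nonassociative algebras (an algebraic expression such as $a+bx_1-2x_2+(x_2c)x_1+x_1x_2$ with $a,b,c\in A$); its value at $(a_1,\dots,a_m)\in A^m$ is the image of $f$ under the homomorphism $\mathcal{F}(X)*A\to A$ that is the identity on $A$ and sends $x_i\mapsto a_i$. The homomorphism $\mathcal{F}(X)*A\to\mathcal{F}(X)$ sending $A$ to $0$ and fixing each $x_i$ sends $f$ to an element $v$ whose degree-one part is $\lambda_1x_1+\dots+\lambda_mx_m$ with $\lambda_j\in\mathbb{F}$; call this the linear part of $f$. The Jacobian matrix of $(f_1,\dots,f_r)$ is $J=[\alpha_{ij}]$, where $\alpha_{ij}\in\mathbb{F}$ is the coefficient of $x_j$ in the linear part of $f_i$. In the notation $A^m$, $A^{m-r}$ above, powers are direct powers. *)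

theory Defs
  imports
    Main
    "HOL-Library.Function_Algebras"
    "HOL-Library.Poly_Mapping"
    "Jordan_Normal_Form.DL_Rank"
begin

section \<open>Nonassociative algebras\<close>

locale nonassoc_algebra = vector_space scale
  for scale :: "'k::field \<Rightarrow> 'a::ab_group_add \<Rightarrow> 'a" +
  fixes mul :: "'a \<Rightarrow> 'a \<Rightarrow> 'a"
  assumes linear_mult_right: "Vector_Spaces.linear scale scale (\<lambda>b. mul a b)"
    and linear_mult_left: "Vector_Spaces.linear scale scale (\<lambda>a. mul a b)"

definition (in vector_space) has_finite_dim :: "'b set \<Rightarrow> nat \<Rightarrow> bool" where
  "has_finite_dim S d \<longleftrightarrow> (\<exists>B. finite B \<and> independent B \<and> span B = S \<and> card B = d)"

text \<open>The free magma: bracketed words. A word together with the values of its letters is a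
  product with a prescribed bracketing.\<close>

datatype 'x magma = Gen 'x | Prod "'x magma" "'x magma"

primrec word_length :: "'x magma \<Rightarrow> nat" where
  "word_length (Gen x) = 1"
| "word_length (Prod u v) = word_length u + word_length v"

primrec bracketed_product :: "('a \<Rightarrow> 'a \<Rightarrow> 'a) \<Rightarrow> 'a magma \<Rightarrow> 'a" where
  "bracketed_product mul (Gen a) = a"
| "bracketed_product mul (Prod u v) = mul (bracketed_product mul u) (bracketed_product mul v)"

definition nilpotent_class_le :: "('a::zero \<Rightarrow> 'a \<Rightarrow> 'a) \<Rightarrow> nat \<Rightarrow> bool" where
  "nilpotent_class_le mul c \<longleftrightarrow> (\<forall>w. word_length w = c + 1 \<longrightarrow> bracketed_product mul w = 0)"

definition nilpotent_algebra :: "('a::zero \<Rightarrow> 'a \<Rightarrow> 'a) \<Rightarrow> bool" where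
  "nilpotent_algebra mul \<longleftrightarrow> (\<exists>c. nilpotent_class_le mul c)"

section \<open>The free algebra\<close>

text \<open>The free (non-unital) nonassociative algebra has the bracketed words as a basis. The
  multiplication instance that \<open>Poly_Mapping\<close> provides is not used: it would need an
  additive structure on the words.\<close>

type_synonym ('x, 'k) free_algebra = "'x magma \<Rightarrow>\<^sub>0 'k"

lift_definition fa_scale :: "'k::field \<Rightarrow> ('x, 'k) free_algebra \<Rightarrow> ('x, 'k) free_algebra"
  is "\<lambda>c f w. c * f w"
  by (rule finite_subset) auto

lift_definition fa_mult ::
    "('x, 'k::field) free_algebra \<Rightarrow> ('x, 'k) free_algebra \<Rightarrow> ('x, 'k) free_algebra"
  is "\<lambda>f g w. case w of Gen x \<Rightarrow> 0 | Prod u v \<Rightarrow> f u * g v"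
proof -
  fix f g :: "'x magma \<Rightarrow> 'k"
  assume "finite {w. f w \<noteq> 0}" "finite {w. g w \<noteq> 0}"
  then have fin: "finite ((\<lambda>(u, v). Prod u v) ` ({w. f w \<noteq> 0} \<times> {w. g w \<noteq> 0}))"
    by (intro finite_imageI finite_cartesian_product)
  show "finite {w. (case w of Gen x \<Rightarrow> 0 | Prod u v \<Rightarrow> f u * g v) \<noteq> 0}"
  proof (rule finite_subset[OF _ fin], rule subsetI)
    fix w
    assume "w \<in> {w. (case w of Gen x \<Rightarrow> 0 | Prod u v \<Rightarrow> f u * g v) \<noteq> 0}"
    then show "w \<in> (\<lambda>(u, v). Prod u v) ` ({w. f w \<noteq> 0} \<times> {w. g w \<noteq> 0})"
      by (cases w) auto
  qed
qed

definition fa_gen :: "'x \<Rightarrow> ('x, 'k::field) free_algebra" where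
  "fa_gen x = Poly_Mapping.single (Gen x) 1"

lemma fa_vector_space: "vector_space (fa_scale :: 'k::field \<Rightarrow> ('x, 'k) free_algebra \<Rightarrow> _)"
  by unfold_locales (transfer; simp add: fun_eq_iff algebra_simps)+

lemma fa_nonassoc_algebra:
  "nonassoc_algebra (fa_scale :: 'k::field \<Rightarrow> ('x, 'k) free_algebra \<Rightarrow> _) fa_mult"
proof -
  interpret vector_space "fa_scale :: 'k \<Rightarrow> ('x, 'k) free_algebra \<Rightarrow> _"
    by (rule fa_vector_space)
  show ?thesis
    by unfold_locales (transfer; simp add: fun_eq_iff algebra_simps split: magma.splits)+
qed

section \<open>The free product of a free algebra and an algebra\<close>

text \<open>The free product (coproduct) of the free algebra on \<open>X\<close> with \<open>A\<close> is given by its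
  presentation: algebraic expressions in the variables \<open>X\<close> and the constants \<open>A\<close>, modulo the
  smallest congruence that contains the axioms of nonassociative algebras and the relations
  identifying the operations on constants with those of \<open>A\<close>. The zero element is the constant
  \<open>0\<close> of \<open>A\<close>, and the negative of \<open>p\<close> is \<open>Scale (-1) p\<close>.\<close>

datatype ('k, 'a, vars: 'x) expr =
    Var 'x
  | Const 'a
  | Add "('k, 'a, 'x) expr" "('k, 'a, 'x) expr"
  | Scale 'k "('k, 'a, 'x) expr"
  | Mult "('k, 'a, 'x) expr" "('k, 'a, 'x) expr"

inductive fp_eq ::
    "('k::field \<Rightarrow> 'a::ab_group_add \<Rightarrow> 'a) \<Rightarrow> ('a \<Rightarrow> 'a \<Rightarrow> 'a) \<Rightarrow> 'x set \<Rightarrow>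
     ('k, 'a, 'x) expr \<Rightarrow> ('k, 'a, 'x) expr \<Rightarrow> bool"
  for scale mul X where
  refl: "vars p \<subseteq> X \<Longrightarrow> fp_eq scale mul X p p"
| sym: "fp_eq scale mul X p q \<Longrightarrow> fp_eq scale mul X q p"
| trans: "fp_eq scale mul X p q \<Longrightarrow> fp_eq scale mul X q s \<Longrightarrow> fp_eq scale mul X p s"
| cong_Add: "fp_eq scale mul X p p' \<Longrightarrow> fp_eq scale mul X q q' \<Longrightarrow>
    fp_eq scale mul X (Add p q) (Add p' q')"
| cong_Scale: "fp_eq scale mul X p p' \<Longrightarrow> fp_eq scale mul X (Scale c p) (Scale c p')"
| cong_Mult: "fp_eq scale mul X p p' \<Longrightarrow> fp_eq scale mul X q q' \<Longrightarrow>
    fp_eq scale mul X (Mult p q) (Mult p' q')"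
| add_assoc: "vars p \<subseteq> X \<Longrightarrow> vars q \<subseteq> X \<Longrightarrow> vars s \<subseteq> X \<Longrightarrow>
    fp_eq scale mul X (Add (Add p q) s) (Add p (Add q s))"
| add_commute: "vars p \<subseteq> X \<Longrightarrow> vars q \<subseteq> X \<Longrightarrow> fp_eq scale mul X (Add p q) (Add q p)"
| add_zero: "vars p \<subseteq> X \<Longrightarrow> fp_eq scale mul X (Add p (Const 0)) p"
| add_minus: "vars p \<subseteq> X \<Longrightarrow> fp_eq scale mul X (Add p (Scale (-1) p)) (Const 0)"
| scale_add_right: "vars p \<subseteq> X \<Longrightarrow> vars q \<subseteq> X \<Longrightarrow>
    fp_eq scale mul X (Scale c (Add p q)) (Add (Scale c p) (Scale c q))"
| scale_add_left: "vars p \<subseteq> X \<Longrightarrow>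
    fp_eq scale mul X (Scale (c + d) p) (Add (Scale c p) (Scale d p))"
| scale_scale: "vars p \<subseteq> X \<Longrightarrow> fp_eq scale mul X (Scale c (Scale d p)) (Scale (c * d) p)"
| scale_one: "vars p \<subseteq> X \<Longrightarrow> fp_eq scale mul X (Scale 1 p) p"
| mult_add_left: "vars p \<subseteq> X \<Longrightarrow> vars q \<subseteq> X \<Longrightarrow> vars s \<subseteq> X \<Longrightarrow>
    fp_eq scale mul X (Mult (Add p q) s) (Add (Mult p s) (Mult q s))"
| mult_add_right: "vars p \<subseteq> X \<Longrightarrow> vars q \<subseteq> X \<Longrightarrow> vars s \<subseteq> X \<Longrightarrow>
    fp_eq scale mul X (Mult p (Add q s)) (Add (Mult p q) (Mult p s))"
| mult_scale_left: "vars p \<subseteq> X \<Longrightarrow> vars q \<subseteq> X \<Longrightarrow>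
    fp_eq scale mul X (Mult (Scale c p) q) (Scale c (Mult p q))"
| mult_scale_right: "vars p \<subseteq> X \<Longrightarrow> vars q \<subseteq> X \<Longrightarrow>
    fp_eq scale mul X (Mult p (Scale c q)) (Scale c (Mult p q))"
| const_add: "fp_eq scale mul X (Add (Const a) (Const b)) (Const (a + b))"
| const_scale: "fp_eq scale mul X (Scale c (Const a)) (Const (scale c a))"
| const_mult: "fp_eq scale mul X (Mult (Const a) (Const b)) (Const (mul a b))"

definition free_product ::
    "('k::field \<Rightarrow> 'a::ab_group_add \<Rightarrow> 'a) \<Rightarrow> ('a \<Rightarrow> 'a \<Rightarrow> 'a) \<Rightarrow> 'x set \<Rightarrow>
     ('k, 'a, 'x) expr set set" where
  "free_product scale mul X = {p. vars p \<subseteq> X} // {(p, q). fp_eq scale mul X p q}"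

text \<open>The homomorphism from the free product to an algebra \<open>B\<close> that is determined by
  \<open>\<phi>\<close> on the variables and by a homomorphism \<open>\<psi>\<close> on \<open>A\<close>: first on expressions, then on
  classes of expressions, where it does not depend on the representative (\<open>fp_hom_class\<close> below).\<close>

primrec interp ::
    "('k \<Rightarrow> 'b::ab_group_add \<Rightarrow> 'b) \<Rightarrow> ('b \<Rightarrow> 'b \<Rightarrow> 'b) \<Rightarrow> ('x \<Rightarrow> 'b) \<Rightarrow> ('a \<Rightarrow> 'b) \<Rightarrow>
     ('k, 'a, 'x) expr \<Rightarrow> 'b" where
  "interp scaleB multB \<phi> \<psi> (Var x) = \<phi> x"
| "interp scaleB multB \<phi> \<psi> (Const a) = \<psi> a"
| "interp scaleB multB \<phi> \<psi> (Add p q) = interp scaleB multB \<phi> \<psi> p + interp scaleB multB \<phi> \<psi> q"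
| "interp scaleB multB \<phi> \<psi> (Scale c p) = scaleB c (interp scaleB multB \<phi> \<psi> p)"
| "interp scaleB multB \<phi> \<psi> (Mult p q) =
    multB (interp scaleB multB \<phi> \<psi> p) (interp scaleB multB \<phi> \<psi> q)"

definition fp_hom ::
    "('k \<Rightarrow> 'b::ab_group_add \<Rightarrow> 'b) \<Rightarrow> ('b \<Rightarrow> 'b \<Rightarrow> 'b) \<Rightarrow> ('x \<Rightarrow> 'b) \<Rightarrow> ('a \<Rightarrow> 'b) \<Rightarrow>
     ('k, 'a, 'x) expr set \<Rightarrow> 'b" where
  "fp_hom scaleB multB \<phi> \<psi> f = the_elem (interp scaleB multB \<phi> \<psi> ` f)"

lemma fp_eq_vars: "fp_eq scale mul X p q \<Longrightarrow> vars p \<subseteq> X \<and> vars q \<subseteq> X"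
  by (induction rule: fp_eq.induct) auto

lemma fp_eq_equiv: "equiv {p. vars p \<subseteq> X} {(p, q). fp_eq scale mul X p q}"
  by (rule equivI)
     (auto simp: refl_on_def sym_on_def trans_on_def
       dest: fp_eq_vars intro: fp_eq.refl fp_eq.sym fp_eq.trans)

lemma fp_eq_interp:
  assumes "nonassoc_algebra scaleB multB"
    and "Vector_Spaces.linear scale scaleB \<psi>"
    and "\<And>a b. \<psi> (mul a b) = multB (\<psi> a) (\<psi> b)"
    and "fp_eq scale mul X p q"
  shows "interp scaleB multB \<phi> \<psi> p = interp scaleB multB \<phi> \<psi> q"
proof -
  interpret B: nonassoc_algebra scaleB multB by fact
  interpret psi: Vector_Spaces.linear scale scaleB \<psi> by fact
  note l = B.linear_mult_left[THEN Vector_Spaces.linear.axioms(3)]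
    and r = B.linear_mult_right[THEN Vector_Spaces.linear.axioms(3)]
  show ?thesis
    using assms(4)
    by (induction rule: fp_eq.induct)
       (simp_all add: assms(3) psi.add psi.scale psi.zero B.scale_right_distrib
          B.scale_left_distrib module_hom.add[OF l] module_hom.add[OF r]
          module_hom.scale[OF l] module_hom.scale[OF r] algebra_simps)
qed

lemma fp_hom_class:
  assumes "nonassoc_algebra scaleB multB"
    and "Vector_Spaces.linear scale scaleB \<psi>"
    and "\<And>a b. \<psi> (mul a b) = multB (\<psi> a) (\<psi> b)"
    and "f \<in> free_product scale mul X" and "p \<in> f"
  shows "fp_hom scaleB multB \<phi> \<psi> f = interp scaleB multB \<phi> \<psi> p"
proof -
  have "interp scaleB multB \<phi> \<psi> q = interp scaleB multB \<phi> \<psi> p" if "q \<in> f" for q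
  proof -
    have "fp_eq scale mul X q p"
      using quotient_eq_iff[OF fp_eq_equiv] assms(4,5) that
      unfolding free_product_def by fastforce
    then show ?thesis
      using fp_eq_interp[of scaleB multB scale \<psi> mul X q p \<phi>] assms(1-3) by blast
  qed
  then have "interp scaleB multB \<phi> \<psi> ` f = {interp scaleB multB \<phi> \<psi> p}"
    using assms(5) by blast
  then show ?thesis
    by (simp add: fp_hom_def)
qed

section \<open>Polynomial functions and the Jacobian matrix\<close>

text \<open>The \<open>n\<close> variables are indexed by \<open>{..<n}\<close>. The \<open>n\<close>-th direct power consists of the functions
  that vanish outside \<open>{..<n}\<close>, so that it is a subspace of the space of all functions
  with pointwise operations.\<close>

definition direct_power :: "nat \<Rightarrow> (nat \<Rightarrow> 'a::zero) set" where
  "direct_power n = {x. \<forall>t. t \<ge> n \<longrightarrow> x t = 0}"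

definition pointwise_scale :: "('k \<Rightarrow> 'a \<Rightarrow> 'a) \<Rightarrow> 'k \<Rightarrow> (nat \<Rightarrow> 'a) \<Rightarrow> (nat \<Rightarrow> 'a)" where
  "pointwise_scale scale c x = (\<lambda>t. scale c (x t))"

definition poly_value ::
    "('k \<Rightarrow> 'a::ab_group_add \<Rightarrow> 'a) \<Rightarrow> ('a \<Rightarrow> 'a \<Rightarrow> 'a) \<Rightarrow> ('k, 'a, nat) expr set \<Rightarrow>
     (nat \<Rightarrow> 'a) \<Rightarrow> 'a" where
  "poly_value scale mul f x = fp_hom scale mul x (\<lambda>a. a) f"

text \<open>The coefficient of the \<open>j\<close>-th variable in the image under the homomorphism to the free
  algebra that kills the constants.\<close>

definition linear_coeff :: "('k::field, 'a, nat) expr set \<Rightarrow> nat \<Rightarrow> 'k" where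
  "linear_coeff f j = Poly_Mapping.lookup (fp_hom fa_scale fa_mult fa_gen (\<lambda>_. 0) f) (Gen j)"

definition jacobian :: "nat \<Rightarrow> nat \<Rightarrow> (nat \<Rightarrow> ('k::field, 'a, nat) expr set) \<Rightarrow> 'k mat" where
  "jacobian r m f = mat r m (\<lambda>(i, j). linear_coeff (f i) j)"

definition solution_set ::
    "('k \<Rightarrow> 'a::ab_group_add \<Rightarrow> 'a) \<Rightarrow> ('a \<Rightarrow> 'a \<Rightarrow> 'a) \<Rightarrow> nat \<Rightarrow> nat \<Rightarrow>
     (nat \<Rightarrow> ('k, 'a, nat) expr set) \<Rightarrow> (nat \<Rightarrow> 'a) set" where
  "solution_set scale mul m r f =
    {x \<in> direct_power m. \<forall>s<r. poly_value scale mul (f s) x = 0}"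

definition splits_variables :: "nat \<Rightarrow> nat \<Rightarrow> (nat \<Rightarrow> nat) \<Rightarrow> (nat \<Rightarrow> nat) \<Rightarrow> bool" where
  "splits_variables m r i j \<longleftrightarrow>
    inj_on i {..<r} \<and> inj_on j {..<m - r} \<and>
    i ` {..<r} \<inter> j ` {..<m - r} = {} \<and> i ` {..<r} \<union> j ` {..<m - r} = {..<m}"

text \<open>The tuple of the coordinates of \<open>x\<close> at \<open>\<sigma> 0, ..., \<sigma> (n - 1)\<close>.\<close>

definition subtuple :: "nat \<Rightarrow> (nat \<Rightarrow> nat) \<Rightarrow> (nat \<Rightarrow> 'a::zero) \<Rightarrow> (nat \<Rightarrow> 'a)" where
  "subtuple n \<sigma> x = (\<lambda>t. if t < n then x (\<sigma> t) else 0)"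

definition polynomial_map ::
    "('k \<Rightarrow> 'a::ab_group_add \<Rightarrow> 'a) \<Rightarrow> ('a \<Rightarrow> 'a \<Rightarrow> 'a) \<Rightarrow> nat \<Rightarrow>
     (nat \<Rightarrow> ('k, 'a, nat) expr set) \<Rightarrow> (nat \<Rightarrow> 'a) \<Rightarrow> (nat \<Rightarrow> 'a)" where
  "polynomial_map scale mul r h y = (\<lambda>s. if s < r then poly_value scale mul (h s) y else 0)"

end

(* Multiplying the system by the inverse of an invertible r x r minor of J turns it into
  x_{i_s} = G_s(x), where the linear part of G_s does not contain the pivot variables. If two points
  have the same free coordinates and their pivot coordinates agree modulo A^k, then the values of G
  agree modulo A^{k+1}, because, up to terms that cancel, a pivot variable occurs in G only inside
  a product. Since A^{c+1} = 0, substituting G into itself c times eliminates the pivot variables. *)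

theory Submission
  imports Defs
begin

section \<open>Direct powers\<close>

lemma sum_fun_apply: "(\<Sum>x\<in>S. f x) t = (\<Sum>x\<in>S. f x t)"
  by (induction S rule: infinite_finite_induct) auto

lemma (in vector_space) pointwise_vector_space:
  "vector_space (pointwise_scale scale :: 'a \<Rightarrow> (nat \<Rightarrow> 'b) \<Rightarrow> _)"
  by unfold_locales (simp_all add: pointwise_scale_def fun_eq_iff algebra_simps)

text \<open>A basis of the direct power consists of the tuples with an element of a basis
  \<open>B\<close> of the algebra in one coordinate and 0 in the others.\<close>

lemma (in vector_space) has_finite_dim_direct_power:
  assumes "has_finite_dim UNIV d"
  shows "vector_space.has_finite_dim (pointwise_scale scale)
    (direct_power n :: (nat \<Rightarrow> 'b) set) (d * n)"
proof -
  interpret P: vector_space "pointwise_scale scale :: 'a \<Rightarrow> (nat \<Rightarrow> 'b) \<Rightarrow> _"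
    by (rule pointwise_vector_space)
  obtain B where B: "finite B" "independent B" "span B = UNIV" "card B = d"
    using assms by (auto simp: has_finite_dim_def)
  define E :: "nat \<Rightarrow> 'b \<Rightarrow> nat \<Rightarrow> 'b" where "E k b = (\<lambda>t. if t = k then b else 0)" for k b
  define C where "C = (\<lambda>(k, b). E k b) ` ({..<n} \<times> B)"
  \<comment> \<open>A zero entry would give the same tuple in every coordinate; excluding it makes
    the pairs (coordinate, basis element) and the tuples correspond one to one.\<close>
  have "0 \<notin> B"
    using B(2) dependent_zero by blast
  have inj: "inj_on (\<lambda>(k, b). E k b) ({..<n} \<times> B)"
  proof (rule inj_onI, clarify)
    fix k b l c
    assume "b \<in> B" "c \<in> B" and eq: "E k b = E l c"
    then have "b \<noteq> 0"
      using \<open>0 \<notin> B\<close> by blast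
    moreover have "E k b k = E l c k"
      by (simp only: eq)
    ultimately show "k = l \<and> b = c"
      by (simp add: E_def split: if_splits)
  qed
  have "finite C"
    using B(1) by (simp add: C_def)
  moreover have "card C = d * n"
    using card_image[OF inj] B(4) by (simp add: C_def card_cartesian_product)
  moreover have "P.independent C"
  proof (rule P.independent_if_scalars_zero[OF \<open>finite C\<close>])
    fix u x
    assume sum0: "(\<Sum>v\<in>C. pointwise_scale scale (u v) v) = 0" and "x \<in> C"
    then obtain k b where x: "x = E k b" and k: "k < n" and b: "b \<in> B"
      by (auto simp: C_def)
    \<comment> \<open>Evaluation at coordinate \<open>k\<close> discards the tuples supported
      elsewhere and leaves a linear relation among the elements of \<open>B\<close>.\<close>
    have "0 = (\<Sum>v\<in>C. pointwise_scale scale (u v) v) k"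
      by (simp add: sum0)
    also have "\<dots> = (\<Sum>v\<in>C. scale (u v) (v k))"
      by (simp add: sum_fun_apply pointwise_scale_def)
    also have "\<dots> = (\<Sum>(l, c)\<in>{..<n} \<times> B. scale (u (E l c)) (E l c k))"
      unfolding C_def by (subst sum.reindex[OF inj]) (simp add: case_prod_unfold)
    also have "\<dots> = (\<Sum>l<n. \<Sum>c\<in>B. scale (u (E l c)) (E l c k))"
      by (simp add: sum.cartesian_product)
    also have "\<dots> = (\<Sum>l<n. if l = k then \<Sum>c\<in>B. scale (u (E k c)) c else 0)"
      by (rule sum.cong) (auto simp: E_def)
    also have "\<dots> = (\<Sum>c\<in>B. scale (u (E k c)) c)"
      using k by simp
    finally have "u (E k b) = 0"
      using B(1,2) b independentD[of B B "\<lambda>c. u (E k c)" b] by simp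
    then show "u x = 0"
      by (simp add: x)
  qed
  moreover have "P.span C = direct_power n"
  proof
    have "P.subspace (direct_power n)"
      by (auto simp: P.subspace_def direct_power_def pointwise_scale_def)
    moreover have "C \<subseteq> direct_power n"
      by (auto simp: C_def E_def direct_power_def)
    ultimately show "P.span C \<subseteq> direct_power n"
      using P.span_minimal by blast
  next
    \<comment> \<open>Placing an element in coordinate \<open>k\<close> is linear, so it carries
      \<open>span B\<close>, the whole algebra, into the span of \<open>C\<close>.\<close>
    have E_span: "E k a \<in> P.span C" if "k < n" for k a
    proof -
      have "module_hom scale (pointwise_scale scale) (E k)"
        by (auto simp: module_hom_iff module_axioms P.module_axioms E_def pointwise_scale_def fun_eq_iff)
      then have "P.span (E k ` B) = E k ` span B"
        by (rule module_hom.span_image)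
      moreover have "E k ` B \<subseteq> C"
        using that by (auto simp: C_def)
      ultimately show ?thesis
        using P.span_mono B(3) by blast
    qed
    show "direct_power n \<subseteq> P.span C"
    proof
      fix x :: "nat \<Rightarrow> 'b"
      assume "x \<in> direct_power n"
      then have "x = (\<Sum>k<n. E k (x k))"
        by (auto simp: sum_fun_apply E_def direct_power_def fun_eq_iff)
      moreover have "(\<Sum>k<n. E k (x k)) \<in> P.span C"
        using E_span by (intro P.span_sum) auto
      ultimately show "x \<in> P.span C"
        by simp
    qed
  qed
  ultimately show ?thesis
    unfolding P.has_finite_dim_def by blast
qed

section \<open>Expressions\<close>

primrec expr_sum :: "nat \<Rightarrow> (nat \<Rightarrow> ('k, 'a::zero, 'x) expr) \<Rightarrow> ('k, 'a, 'x) expr" where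
  "expr_sum 0 e = Const 0"
| "expr_sum (Suc n) e = Add (expr_sum n e) (e n)"

primrec expr_subst :: "('x \<Rightarrow> ('k, 'a, 'y) expr) \<Rightarrow> ('k, 'a, 'x) expr \<Rightarrow> ('k, 'a, 'y) expr" where
  "expr_subst \<sigma> (Var x) = \<sigma> x"
| "expr_subst \<sigma> (Const a) = Const a"
| "expr_subst \<sigma> (Add p q) = Add (expr_subst \<sigma> p) (expr_subst \<sigma> q)"
| "expr_subst \<sigma> (Scale c p) = Scale c (expr_subst \<sigma> p)"
| "expr_subst \<sigma> (Mult p q) = Mult (expr_subst \<sigma> p) (expr_subst \<sigma> q)"

text \<open>The degree-one coefficient computed by recursion on a representative, without passing
  through the free algebra. Constants are killed there, and a product contains only words of length
  at least 2; \<open>lookup_interp_fa_Gen\<close> proves the agreement.\<close>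

primrec expr_linear_coeff :: "('k::field, 'a, 'x) expr \<Rightarrow> 'x \<Rightarrow> 'k" where
  "expr_linear_coeff (Var x) y = (if x = y then 1 else 0)"
| "expr_linear_coeff (Const a) y = 0"
| "expr_linear_coeff (Add p q) y = expr_linear_coeff p y + expr_linear_coeff q y"
| "expr_linear_coeff (Scale c p) y = c * expr_linear_coeff p y"
| "expr_linear_coeff (Mult p q) y = 0"

lemma vars_expr_sum: "vars (expr_sum n e) = (\<Union>t<n. vars (e t))"
  by (induction n) (auto simp: less_Suc_eq)

lemma vars_expr_subst: "vars (expr_subst \<sigma> p) = (\<Union>x\<in>vars p. vars (\<sigma> x))"
  by (induction p) auto

lemma interp_expr_subst:
  "interp sc mu \<phi> \<psi> (expr_subst \<sigma> p) = interp sc mu (\<lambda>x. interp sc mu \<phi> \<psi> (\<sigma> x)) \<psi> p"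
  by (induction p) auto

lemma interp_expr_sum:
  "\<psi> 0 = 0 \<Longrightarrow> interp sc mu \<phi> \<psi> (expr_sum n e) = (\<Sum>t<n. interp sc mu \<phi> \<psi> (e t))"
  by (induction n) auto

lemma interp_cong_vars:
  "(\<And>x. x \<in> vars p \<Longrightarrow> \<phi> x = \<phi>' x) \<Longrightarrow> interp sc mu \<phi> \<psi> p = interp sc mu \<phi>' \<psi> p"
  by (induction p) auto

lemma expr_linear_coeff_sum:
  "expr_linear_coeff (expr_sum n e) y = (\<Sum>t<n. expr_linear_coeff (e t) y)"
  by (induction n) auto

lemma lookup_fa_scale: "Poly_Mapping.lookup (fa_scale c f) w = c * Poly_Mapping.lookup f w"
  by transfer simp

lemma lookup_fa_mult_Gen: "Poly_Mapping.lookup (fa_mult f g) (Gen x) = 0"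
  by transfer simp

lemma lookup_interp_fa_Gen:
  "Poly_Mapping.lookup (interp fa_scale fa_mult fa_gen (\<lambda>_. 0) p) (Gen y) = expr_linear_coeff p y"
  by (induction p)
     (auto simp: lookup_add lookup_fa_scale lookup_fa_mult_Gen fa_gen_def lookup_single when_def)

section \<open>Nilpotent algebras\<close>

context nonassoc_algebra
begin

lemmas mul_right_hom = linear_mult_right[THEN Vector_Spaces.linear.axioms(3)]
  and mul_left_hom = linear_mult_left[THEN Vector_Spaces.linear.axioms(3)]

lemmas mul_left_simps = module_hom.add[OF mul_left_hom] module_hom.scale[OF mul_left_hom]
    module_hom.zero[OF mul_left_hom] module_hom.diff[OF mul_left_hom]
  and mul_right_simps = module_hom.add[OF mul_right_hom] module_hom.scale[OF mul_right_hom]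
    module_hom.zero[OF mul_right_hom] module_hom.diff[OF mul_right_hom]

abbreviation expr_value :: "('x \<Rightarrow> 'a) \<Rightarrow> ('k, 'a, 'x) expr \<Rightarrow> 'a" where
  "expr_value \<phi> p \<equiv> interp scale mul \<phi> (\<lambda>a. a) p"

text \<open>\<open>ideal_power k\<close> is $A^{k+1}$ for the recursion $A^{n+1} = A^n A + A A^n$; it suffices to multiply
  by $A$ on one side because only the contraction property below is needed.\<close>

primrec ideal_power :: "nat \<Rightarrow> 'a set" where
  "ideal_power 0 = UNIV"
| "ideal_power (Suc k) =
    span ({mul a b |a b. a \<in> ideal_power k} \<union> {mul a b |a b. b \<in> ideal_power k})"

lemma subspace_ideal_power: "subspace (ideal_power k)"
  by (cases k) (auto simp: subspace_UNIV subspace_span)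

lemma mul_left_ideal_power: "a \<in> ideal_power k \<Longrightarrow> mul a b \<in> ideal_power (Suc k)"
  by (auto intro!: span_base)

lemma mul_right_ideal_power: "b \<in> ideal_power k \<Longrightarrow> mul a b \<in> ideal_power (Suc k)"
  by (auto intro!: span_base)

lemma ideal_power_Suc_subset: "ideal_power (Suc k) \<subseteq> ideal_power k"
proof (induction k)
  case (Suc k)
  then show ?case
    unfolding ideal_power.simps(2)[of "Suc k"]
    \<comment> \<open>Only the right-hand side is unfolded; the occurrences inside the generators
      stay folded, so that the induction hypothesis compares the two generating sets.\<close>
    by (subst (3) ideal_power.simps(2)) (rule span_mono, blast)
qed simp

text \<open>Multiplying a word by one more letter, on either side, raises its length by one, and
  bilinearity extends this to spans. Words of length c + 1 thus control
  \<open>ideal_power c\<close>, which links the filtration to the nilpotency class.\<close>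

lemma ideal_power_subset_span_products:
  "ideal_power k \<subseteq> span {bracketed_product mul w |w. word_length w = Suc k}"
    (is "_ \<subseteq> span (?W k)")
proof (induction k)
  case 0
  have "a \<in> ?W 0" for a
    by (rule CollectI, rule exI[of _ "Gen a"]) simp
  then show ?case
    by (auto intro: span_base)
next
  case (Suc k)
  have left: "mul a b \<in> span (?W (Suc k))" if "a \<in> span (?W k)" for a b
  proof -
    have "?W k \<subseteq> {a. mul a b \<in> span (?W (Suc k))}"
    proof clarify
      fix w :: "'a magma"
      assume "word_length w = Suc k"
      then show "mul (bracketed_product mul w) b \<in> span (?W (Suc k))"
        by (intro span_base CollectI exI[of _ "Prod w (Gen b)"]) simp
    qed
    moreover have "subspace {a. mul a b \<in> span (?W (Suc k))}"
      by (auto simp: subspace_def mul_left_simps span_zero span_add span_scale)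
    ultimately show ?thesis
      using span_minimal that by blast
  qed
  have right: "mul a b \<in> span (?W (Suc k))" if "b \<in> span (?W k)" for a b
  proof -
    have "?W k \<subseteq> {b. mul a b \<in> span (?W (Suc k))}"
    proof clarify
      fix w :: "'a magma"
      assume "word_length w = Suc k"
      then show "mul a (bracketed_product mul w) \<in> span (?W (Suc k))"
        by (intro span_base CollectI exI[of _ "Prod (Gen a) w"]) simp
    qed
    moreover have "subspace {b. mul a b \<in> span (?W (Suc k))}"
      by (auto simp: subspace_def mul_right_simps span_zero span_add span_scale)
    ultimately show ?thesis
      using span_minimal that by blast
  qed
  show ?case
    unfolding ideal_power.simps(2)
    by (rule span_minimal) (use Suc.IH left right in \<open>auto simp: subspace_span\<close>)
qed

lemma ideal_power_eq_0:
  assumes "nilpotent_class_le mul c"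
  shows "ideal_power c = {0}"
proof -
  have "{bracketed_product mul w |w. word_length w = Suc c} \<subseteq> {0}"
    using assms by (auto simp: nilpotent_class_le_def)
  then have "ideal_power c \<subseteq> {0}"
    using ideal_power_subset_span_products[of c] span_minimal[OF _ subspace_single_0] by blast
  then show ?thesis
    using subspace_0[OF subspace_ideal_power] by blast
qed

section \<open>Values of expressions modulo the powers of the algebra\<close>

lemma expr_value_diff_in_ideal_power:
  assumes "\<And>x. x \<in> vars p \<Longrightarrow> \<phi> x - \<phi>' x \<in> ideal_power k"
  shows "expr_value \<phi> p - expr_value \<phi>' p \<in> ideal_power k"
  using assms
proof (induction p)
  case (Const a)
  then show ?case
    by (simp add: subspace_0[OF subspace_ideal_power])
next
  case (Add p q)
  then have "(expr_value \<phi> p - expr_value \<phi>' p) + (expr_value \<phi> q - expr_value \<phi>' q) \<in> ideal_power k"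
    by (intro subspace_add[OF subspace_ideal_power]) auto
  then show ?case
    by (simp add: algebra_simps)
next
  case (Scale c p)
  then have "scale c (expr_value \<phi> p - expr_value \<phi>' p) \<in> ideal_power k"
    by (intro subspace_scale[OF subspace_ideal_power]) auto
  then show ?case
    by (simp add: algebra_simps)
next
  case (Mult p q)
  let ?p = "expr_value \<phi> p" and ?p' = "expr_value \<phi>' p"
    and ?q = "expr_value \<phi> q" and ?q' = "expr_value \<phi>' q"
  \<comment> \<open>Telescoping pq - p'q' = (p - p')q + p'(q - q') puts a small difference into one
    factor of each summand.\<close>
  have "mul (?p - ?p') ?q + mul ?p' (?q - ?q') \<in> ideal_power (Suc k)"
    using Mult by (intro subspace_add[OF subspace_ideal_power] mul_left_ideal_power
        mul_right_ideal_power) auto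
  then show ?case
    using ideal_power_Suc_subset[of k] by (auto simp: mul_left_simps mul_right_simps)
qed auto

text \<open>A first-order Taylor formula. Variables, sums and multiples satisfy it directly; in a
  product one factor of each telescoped summand lies in \<open>ideal_power k\<close>, so the product
  is already in the next power and contributes nothing linear.\<close>

lemma expr_value_linearization:
  assumes "finite X" and "vars p \<subseteq> X" and "\<And>x. x \<in> X \<Longrightarrow> \<phi> x - \<phi>' x \<in> ideal_power k"
  shows "expr_value \<phi> p - expr_value \<phi>' p
      - (\<Sum>x\<in>X. scale (expr_linear_coeff p x) (\<phi> x - \<phi>' x)) \<in> ideal_power (Suc k)"
    (is "_ - ?L p \<in> _")
  using assms(2)
proof (induction p)
  case (Var y)
  have "?L (Var y) = (\<Sum>x\<in>X. if x = y then \<phi> x - \<phi>' x else 0)"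
    by (rule sum.cong) auto
  then show ?case
    using Var assms(1) subspace_0[OF subspace_ideal_power, of "Suc k"] by simp
next
  case (Const a)
  then show ?case
    using subspace_0[OF subspace_ideal_power, of "Suc k"] by simp
next
  case (Add p q)
  have "?L (Add p q) = ?L p + ?L q"
    by (simp add: scale_left_distrib sum.distrib)
  moreover have "(expr_value \<phi> p - expr_value \<phi>' p - ?L p)
      + (expr_value \<phi> q - expr_value \<phi>' q - ?L q) \<in> ideal_power (Suc k)"
    by (rule subspace_add[OF subspace_ideal_power]) (use Add in auto)
  ultimately show ?case
    by (simp add: algebra_simps del: ideal_power.simps)
next
  case (Scale c p)
  have "?L (Scale c p) = scale c (?L p)"
    by (simp add: scale_sum_right)
  moreover have "scale c (expr_value \<phi> p - expr_value \<phi>' p - ?L p) \<in> ideal_power (Suc k)"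
    by (rule subspace_scale[OF subspace_ideal_power]) (use Scale in auto)
  ultimately show ?case
    by (simp add: scale_right_diff_distrib del: ideal_power.simps)
next
  case (Mult p q)
  let ?p = "expr_value \<phi> p" and ?p' = "expr_value \<phi>' p"
    and ?q = "expr_value \<phi> q" and ?q' = "expr_value \<phi>' q"
  have "?p - ?p' \<in> ideal_power k" "?q - ?q' \<in> ideal_power k"
    using Mult.prems assms(3) by (auto intro!: expr_value_diff_in_ideal_power)
  then have "mul (?p - ?p') ?q + mul ?p' (?q - ?q') \<in> ideal_power (Suc k)"
    by (intro subspace_add[OF subspace_ideal_power] mul_left_ideal_power mul_right_ideal_power)
  then show ?case
    by (simp add: mul_left_simps mul_right_simps del: ideal_power.simps)
qed

end

section \<open>Elimination of the pivot variables by iteration\<close>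

context nonassoc_algebra
begin

text \<open>On the pivot variables \<open>G\<close> is a contraction of the filtration by the powers of the algebra,
  and its iterates, as expressions in the free variables, become stationary after \<open>c\<close> steps.\<close>

lemma polynomial_fixed_point:
  fixes G :: "nat \<Rightarrow> ('k, 'a, nat) expr"
  assumes nil: "nilpotent_class_le mul c"
    and split: "splits_variables m r i j"
    and vars_G: "\<And>s. s < r \<Longrightarrow> vars (G s) \<subseteq> {..<m}"
    and no_linear: "\<And>s t. s < r \<Longrightarrow> t < r \<Longrightarrow> expr_linear_coeff (G s) (i t) = 0"
  obtains H :: "nat \<Rightarrow> ('k, 'a, nat) expr"
  where "\<forall>s<r. vars (H s) \<subseteq> {..<m - r}"
    and "\<forall>x. (\<forall>s<r. x (i s) = expr_value x (G s)) \<longleftrightarrow>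
      (\<forall>s<r. x (i s) = expr_value (subtuple (m - r) j x) (H s))"
proof -
  have inj_i: "inj_on i {..<r}" and inj_j: "inj_on j {..<m - r}"
    and disj: "i ` {..<r} \<inter> j ` {..<m - r} = {}"
    and cover: "i ` {..<r} \<union> j ` {..<m - r} = {..<m}"
    using split by (auto simp: splits_variables_def)
  have variable_cases: thesis
    if "v < m" "\<And>s. s < r \<Longrightarrow> v = i s \<Longrightarrow> thesis" "\<And>t. t < m - r \<Longrightarrow> v = j t \<Longrightarrow> thesis"
    for v thesis
    using that cover by blast
  \<comment> \<open>Pivot variables are replaced by the current approximations, free variables are
    renumbered from 0. Values at indices from \<open>m\<close> on are arbitrary and never reached,
    since \<open>G\<close> mentions only variables below \<open>m\<close>.\<close>
  define \<sigma> :: "(nat \<Rightarrow> ('k, 'a, nat) expr) \<Rightarrow> nat \<Rightarrow> ('k, 'a, nat) expr" where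
    "\<sigma> h v = (if v \<in> i ` {..<r} then h (inv_into {..<r} i v)
      else Var (inv_into {..<m - r} j v))" for h v
  have \<sigma>_i: "\<sigma> h (i s) = h s" if "s < r" for h s
    using that inj_i by (simp add: \<sigma>_def)
  have \<sigma>_j: "\<sigma> h (j t) = Var t" if "t < m - r" for h t
  proof -
    have "j t \<notin> i ` {..<r}"
      using disj that by blast
    then show ?thesis
      using that inj_j by (simp add: \<sigma>_def)
  qed
  \<comment> \<open>The iteration starts from the constant 0: any two starting values agree modulo
    \<open>ideal_power 0\<close>, which is the whole algebra.\<close>
  define h :: "nat \<Rightarrow> nat \<Rightarrow> ('k, 'a, nat) expr" where
    "h n = rec_nat (\<lambda>s. Const 0) (\<lambda>_ h s. expr_subst (\<sigma> h) (G s)) n" for n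
  have h_0: "h 0 s = Const 0" and h_Suc: "h (Suc n) s = expr_subst (\<sigma> (h n)) (G s)" for n s
    by (simp_all add: h_def)
  have vars_h: "vars (h n s) \<subseteq> {..<m - r}" if "s < r" for n s
    using that
  proof (induction n arbitrary: s)
    case (Suc n)
    have "vars (\<sigma> (h n) v) \<subseteq> {..<m - r}" if "v < m" for v
      using that by (cases rule: variable_cases) (use Suc.IH in \<open>auto simp: \<sigma>_i \<sigma>_j subset_iff\<close>)
    then show ?case
      using vars_G[OF Suc.prems] by (auto simp: h_Suc vars_expr_subst)
  qed (simp add: h_0)
  have contraction: "expr_value \<phi> (G s) - expr_value \<phi>' (G s) \<in> ideal_power (Suc k)"
    if pivot: "\<And>s. s < r \<Longrightarrow> \<phi> (i s) - \<phi>' (i s) \<in> ideal_power k"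
      and free: "\<And>t. t < m - r \<Longrightarrow> \<phi> (j t) = \<phi>' (j t)" and "s < r" for \<phi> \<phi>' k s
  proof -
    have "\<phi> v - \<phi>' v \<in> ideal_power k" if "v < m" for v
      using that
      by (cases rule: variable_cases)
         (use pivot free subspace_0[OF subspace_ideal_power] in auto)
    then have "expr_value \<phi> (G s) - expr_value \<phi>' (G s)
        - (\<Sum>v<m. scale (expr_linear_coeff (G s) v) (\<phi> v - \<phi>' v)) \<in> ideal_power (Suc k)"
      using vars_G[OF \<open>s < r\<close>] by (intro expr_value_linearization) auto
    \<comment> \<open>Each linear term dies for one of two reasons: a pivot has coefficient 0 in
      \<open>G\<close>, and a free coordinate has difference 0.\<close>
    moreover have "scale (expr_linear_coeff (G s) v) (\<phi> v - \<phi>' v) = 0" if "v < m" for v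
      using that by (cases rule: variable_cases) (use no_linear \<open>s < r\<close> free in auto)
    ultimately show ?thesis
      by (simp del: ideal_power.simps)
  qed
  have equiv: "(\<forall>s<r. x (i s) = expr_value x (G s)) \<longleftrightarrow>
      (\<forall>s<r. x (i s) = expr_value (subtuple (m - r) j x) (h c s))" for x
  proof -
    \<comment> \<open>The point with the free coordinates of \<open>x\<close> and the
      \<open>n\<close>-th approximations as pivot coordinates.\<close>
    define z where "z n v = expr_value (subtuple (m - r) j x) (\<sigma> (h n) v)" for n v
    have z_i: "z n (i s) = expr_value (subtuple (m - r) j x) (h n s)" if "s < r" for n s
      using that by (simp add: z_def \<sigma>_i)
    have z_j: "z n (j t) = x (j t)" if "t < m - r" for n t
      using that by (simp add: z_def \<sigma>_j subtuple_def)
    have z_Suc: "z (Suc n) (i s) = expr_value (z n) (G s)" if "s < r" for n s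
      unfolding z_i[OF that] h_Suc interp_expr_subst by (simp add: z_def[abs_def])
    have eq_if: "a = b" if "a - b \<in> ideal_power c" for a b
      using that ideal_power_eq_0[OF nil] by simp
    show ?thesis
    proof
      assume x: "\<forall>s<r. x (i s) = expr_value x (G s)"
      \<comment> \<open>A fixed point is compared with the iterates: each application of
        \<open>G\<close> gains one power, and at \<open>n = c\<close> the difference is 0.\<close>
      have "\<forall>s<r. x (i s) - z n (i s) \<in> ideal_power n" for n
      proof (induction n)
        case (Suc n)
        have "expr_value x (G s) - expr_value (z n) (G s) \<in> ideal_power (Suc n)" if "s < r" for s
          using Suc that by (intro contraction) (auto simp: z_j)
        then show ?case
          using x by (simp add: z_Suc del: ideal_power.simps)
      qed simp
      then show "\<forall>s<r. x (i s) = expr_value (subtuple (m - r) j x) (h c s)"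
        using eq_if by (simp add: z_i)
    next
      assume x: "\<forall>s<r. x (i s) = expr_value (subtuple (m - r) j x) (h c s)"
      \<comment> \<open>Conversely, consecutive iterates are compared. They coincide from
        \<open>n = c\<close> on, so the \<open>c\<close>-th iterate is itself a fixed point.\<close>
      have "\<forall>s<r. z (Suc n) (i s) - z n (i s) \<in> ideal_power n" for n
      proof (induction n)
        case (Suc n)
        have "expr_value (z (Suc n)) (G s) - expr_value (z n) (G s) \<in> ideal_power (Suc n)"
          if "s < r" for s
          using Suc that by (intro contraction) (auto simp: z_j)
        then show ?case
          by (simp add: z_Suc del: ideal_power.simps)
      qed simp
      then have stationary: "z (Suc c) (i s) = z c (i s)" if "s < r" for s
        using eq_if that by blast
      have "x v = z c v" if "v < m" for v
        using that by (cases rule: variable_cases) (use x in \<open>auto simp: z_i z_j\<close>)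
      then have "expr_value x (G s) = expr_value (z c) (G s)" if "s < r" for s
        using vars_G[OF that] by (intro interp_cong_vars) auto
      then show "\<forall>s<r. x (i s) = expr_value x (G s)"
        using x stationary z_Suc z_i by metis
    qed
  qed
  show thesis
    using that[of "h c"] vars_h equiv by blast
qed

section \<open>Values and linear parts of classes of expressions\<close>

lemma expr_value_class:
  assumes "f \<in> free_product scale mul X" and "p \<in> f"
  shows "poly_value scale mul f x = expr_value x p"
  unfolding poly_value_def
  using fp_hom_class[OF nonassoc_algebra_axioms linear_ident _ assms] by simp

text \<open>Killing the constants is a homomorphism into the free algebra, so
  \<open>fp_hom_class\<close> allows the coefficient to be read off any representative.\<close>

lemma linear_coeff_class:
  assumes "f \<in> free_product scale mul X" and "p \<in> f"
  shows "linear_coeff f y = expr_linear_coeff p y"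
proof -
  interpret F: nonassoc_algebra "fa_scale :: 'k \<Rightarrow> (nat, 'k) free_algebra \<Rightarrow> _" fa_mult
    by (rule fa_nonassoc_algebra)
  have "Vector_Spaces.linear scale (fa_scale :: 'k \<Rightarrow> (nat, 'k) free_algebra \<Rightarrow> _) (\<lambda>_. 0)"
    by unfold_locales simp_all
  then have "fp_hom fa_scale fa_mult fa_gen (\<lambda>_. 0) f = interp fa_scale fa_mult fa_gen (\<lambda>_. 0) p"
    using fp_hom_class[OF F.nonassoc_algebra_axioms _ _ assms]
    by (simp add: module_hom.zero[OF F.mul_left_hom])
  then show ?thesis
    by (simp add: linear_coeff_def lookup_interp_fa_Gen)
qed

end

section \<open>Pivot columns\<close>

text \<open>A maximal independent set of columns has \<open>r\<close> elements and forms an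
  invertible square block; \<open>M\<close> is its inverse. Both products are recorded:
  \<open>M\<close> times the block normalizes the linear part in the pivots, and the block times
  \<open>M\<close> recovers the original equations from their combinations.\<close>

lemma full_rank_pivots:
  fixes A :: "'k::field mat"
  assumes A: "A \<in> carrier_mat r m" and rank: "vec_space.rank r A = r"
  obtains i M where "inj_on i {..<r}" and "i ` {..<r} \<subseteq> {..<m}"
    and "\<forall>s<r. \<forall>t<r. (\<Sum>k<r. M s k * A $$ (k, i t)) = (if s = t then 1 else 0)"
    and "\<forall>k<r. \<forall>l<r. (\<Sum>t<r. A $$ (k, i t) * M t l) = (if k = l then 1 else 0)"
proof -
  interpret vec_space "TYPE('k)" r .
  obtain S where S: "maximal S (\<lambda>T. T \<subseteq> set (cols A) \<and> lin_indpt T)"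
    using maximal_exists_superset[of "set (cols A)" "\<lambda>T. T \<subseteq> set (cols A) \<and> lin_indpt T" "{}"]
    by (auto simp: subset_li_is_li lin_dep_def)
  then have sub: "S \<subseteq> set (cols A)" and li: "lin_indpt S"
    by (auto simp: maximal_def)
  have card_S: "card S = r"
    using rank_card_indpt[OF A S] rank by simp
  obtain vs where vs: "set vs = S" "distinct vs"
    using finite_distinct_list[OF finite_subset[OF sub]] by auto
  then have len: "length vs = r"
    using card_S distinct_card by fastforce
  have vs_carrier: "set vs \<subseteq> carrier_vec r"
    using sub cols_dim[of A] A vs by auto
  define C where "C = mat_of_cols r vs"
  have C: "C \<in> carrier_mat r r" and cols_C: "cols C = vs"
    using len vs_carrier mat_of_cols_carrier(1)[of r vs] by (simp_all add: C_def)
  have "rank C = r"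
    using lin_indpt_full_rank[OF C] cols_C vs li by simp
  then have "det C \<noteq> 0"
    using det_rank_iff[OF C] by simp
  then have "C \<in> Units (ring_mat TYPE('k) r ())"
    by (rule det_non_zero_imp_unit[OF C])
  then obtain N where N: "N \<in> carrier_mat r r" "N * C = 1\<^sub>m r" "C * N = 1\<^sub>m r"
    by (auto simp: Units_def ring_mat_def)
  have "\<exists>l<m. col A l = vs ! t" if "t < r" for t
  proof -
    have "vs ! t \<in> set (cols A)"
      using that sub vs len nth_mem by blast
    then show ?thesis
      using A by (auto simp: cols_def)
  qed
  then obtain i where i: "\<And>t. t < r \<Longrightarrow> i t < m \<and> col A (i t) = vs ! t"
    by metis
  \<comment> \<open>Equal indices would give equal columns, hence equal entries of the distinct list
    \<open>vs\<close>.\<close>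
  have "inj_on i {..<r}"
    using i vs(2) len by (intro inj_onI) (metis lessThan_iff nth_eq_iff_index_eq)
  moreover have C_A: "C $$ (k, t) = A $$ (k, i t)" if "k < r" "t < r" for k t
  proof -
    have "C $$ (k, t) = vs ! t $ k"
      using that len by (simp add: C_def mat_of_cols_def)
    also have "\<dots> = A $$ (k, i t)"
      using i[OF that(2)] A that(1) by (metis carrier_matD index_col)
    finally show ?thesis .
  qed
  have "(\<Sum>k<r. N $$ (s, k) * A $$ (k, i t)) = (if s = t then 1 else 0)"
    if "s < r" "t < r" for s t
  proof -
    have "(\<Sum>k<r. N $$ (s, k) * A $$ (k, i t)) = (N * C) $$ (s, t)"
      using N(1) C that by (simp add: scalar_prod_def atLeast0LessThan C_A)
    then show ?thesis
      using N(2) that by simp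
  qed
  moreover have "(\<Sum>t<r. A $$ (k, i t) * N $$ (t, l)) = (if k = l then 1 else 0)"
    if "k < r" "l < r" for k l
  proof -
    have "(\<Sum>t<r. A $$ (k, i t) * N $$ (t, l)) = (C * N) $$ (k, l)"
      using N(1) C that by (simp add: scalar_prod_def atLeast0LessThan C_A)
    then show ?thesis
      using N(3) that by simp
  qed
  ultimately show thesis
    using that[of i "\<lambda>s k. N $$ (s, k)"] i by blast
qed

section \<open>Pivot and free coordinates\<close>

lemma splits_variables_exists:
  assumes "inj_on i {..<r}" and "i ` {..<r} \<subseteq> {..<m}"
  obtains j where "splits_variables m r i j"
proof -
  have "card ({..<m} - i ` {..<r}) = m - r"
    using assms by (simp add: card_Diff_subset card_image)
  then obtain j where "bij_betw j {..<m - r} ({..<m} - i ` {..<r})"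
    using ex_bij_betw_nat_finite[of "{..<m} - i ` {..<r}"] by (auto simp: atLeast0LessThan)
  then have "splits_variables m r i j"
    using assms by (auto simp: splits_variables_def bij_betw_def)
  then show thesis ..
qed

text \<open>Free and pivot coordinates can be prescribed independently; this provides a solution
  above every point of the free space. The default 0 outside both index sets keeps the tuple in the
  direct power.\<close>

lemma splits_variables_glue:
  fixes y :: "nat \<Rightarrow> 'a::zero"
  assumes "splits_variables m r i j" and "y \<in> direct_power (m - r)"
  obtains x where "x \<in> direct_power m" and "subtuple (m - r) j x = y"
    and "\<And>s. s < r \<Longrightarrow> x (i s) = w s"
proof -
  define x where "x v = (if v \<in> i ` {..<r} then w (inv_into {..<r} i v)
    else if v \<in> j ` {..<m - r} then y (inv_into {..<m - r} j v) else 0)" for v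
  have inj: "inj_on i {..<r}" "inj_on j {..<m - r}"
    and disj: "i ` {..<r} \<inter> j ` {..<m - r} = {}"
    and cover: "i ` {..<r} \<union> j ` {..<m - r} = {..<m}"
    using assms(1) by (auto simp: splits_variables_def)
  have "x \<in> direct_power m"
    unfolding direct_power_def
  proof (rule CollectI, intro allI impI)
    fix v
    assume "m \<le> v"
    then have "v \<notin> i ` {..<r} \<union> j ` {..<m - r}"
      unfolding cover by simp
    then show "x v = 0"
      by (simp add: x_def)
  qed
  moreover have "x (i s) = w s" if "s < r" for s
    using that inj by (simp add: x_def)
  moreover have "x (j t) = y t" if "t < m - r" for t
  proof -
    have "j t \<notin> i ` {..<r}"
      using disj that by blast
    then show ?thesis
      using that inj by (simp add: x_def)
  qed
  then have "subtuple (m - r) j x = y"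
    using assms(2) by (auto simp: subtuple_def direct_power_def fun_eq_iff)
  ultimately show thesis
    using that by blast
qed

section \<open>Solving the system in terms of the free variables\<close>

theorem theorem1p2:
  fixes scale :: "'k::field \<Rightarrow> 'a::ab_group_add \<Rightarrow> 'a"
    and mul :: "'a \<Rightarrow> 'a \<Rightarrow> 'a"
    and r m :: nat
    and f :: "nat \<Rightarrow> ('k, 'a, nat) expr set"
  assumes "nonassoc_algebra scale mul"
    and "\<exists>a::'a. a \<noteq> 0"
    and "nilpotent_algebra mul"
    and "r \<le> m"
    and "\<And>s. s < r \<Longrightarrow> f s \<in> free_product scale mul {..<m}"
    and "vec_space.rank r (jacobian r m f) = r"
  shows "\<exists>i j h.
      splits_variables m r i j \<and>
      (\<forall>s<r. h s \<in> free_product scale mul {..<m - r}) \<and>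
      (\<forall>x\<in>direct_power m.
         x \<in> solution_set scale mul m r f \<longleftrightarrow>
         (\<forall>s<r. x (i s) = poly_value scale mul (h s) (subtuple (m - r) j x))) \<and>
      (\<forall>d. vector_space.has_finite_dim scale (UNIV :: 'a set) d \<longrightarrow>
         vector_space.has_finite_dim (pointwise_scale scale)
           (direct_power (m - r) :: (nat \<Rightarrow> 'a) set) (d * (m - r)) \<and>
         (\<lambda>x. (subtuple (m - r) j x, subtuple r i x)) ` solution_set scale mul m r f =
         {(y, polynomial_map scale mul r h y) |y. y \<in> direct_power (m - r)})"
proof -
  interpret nonassoc_algebra scale mul by fact
  obtain c where nil: "nilpotent_class_le mul c"
    using assms(3) by (auto simp: nilpotent_algebra_def)
  \<comment> \<open>A class in the quotient is the class of an expression in the allowed variables,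
    and reflexivity puts that expression into it.\<close>
  have "\<exists>p. p \<in> f s \<and> vars p \<subseteq> {..<m}" if "s < r" for s
    using assms(5)[OF that] unfolding free_product_def
    by (auto elim!: quotientE intro: fp_eq.refl)
  then obtain p where p: "\<And>s. s < r \<Longrightarrow> p s \<in> f s" "\<And>s. s < r \<Longrightarrow> vars (p s) \<subseteq> {..<m}"
    by metis
  have value_f: "poly_value scale mul (f s) x = expr_value x (p s)" if "s < r" for s x
    using expr_value_class assms(5) p(1) that by blast
  let ?J = "jacobian r m f"
  have J: "?J \<in> carrier_mat r m"
    by (simp add: jacobian_def)
  obtain i M where i: "inj_on i {..<r}" "i ` {..<r} \<subseteq> {..<m}"
    and MJ: "\<forall>s<r. \<forall>t<r.
      (\<Sum>k<r. M s k * ?J $$ (k, i t)) = (if s = t then 1 else 0)"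
    and JM: "\<forall>k<r. \<forall>l<r.
      (\<Sum>t<r. ?J $$ (k, i t) * M t l) = (if k = l then 1 else 0)"
    using full_rank_pivots[OF J assms(6)] .
  obtain j where split: "splits_variables m r i j"
    using splits_variables_exists[OF i] .
  \<comment> \<open>The system multiplied by \<open>M\<close> has x_{i_s} as its linear part in the
    pivots; subtracting it from the pivot cancels that part and turns the equations into a
    fixed-point problem.\<close>
  define G where "G s = Add (Var (i s)) (Scale (-1) (expr_sum r (\<lambda>k. Scale (M s k) (p k))))" for s
  have vars_G: "vars (G s) \<subseteq> {..<m}" if "s < r" for s
    using p(2) i(2) that by (auto simp: G_def vars_expr_sum)
  have no_linear: "expr_linear_coeff (G s) (i t) = 0" if "s < r" "t < r" for s t
  proof -
    have "?J $$ (k, i t) = expr_linear_coeff (p k) (i t)" if "k < r" for k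
    proof -
      have "i t < m"
        using i(2) \<open>t < r\<close> by auto
      then show ?thesis
        using linear_coeff_class[OF assms(5) p(1)] that by (simp add: jacobian_def)
    qed
    then have "(\<Sum>k<r. M s k * expr_linear_coeff (p k) (i t)) = (if s = t then 1 else 0)"
      using MJ[rule_format, OF that] by simp
    moreover have "i s = i t \<longleftrightarrow> s = t"
      using i(1) that by (simp add: inj_on_eq_iff)
    ultimately show ?thesis
      by (simp add: G_def expr_linear_coeff_sum)
  qed
  have value_G: "x (i s) = expr_value x (G s)
      \<longleftrightarrow> (\<Sum>k<r. scale (M s k) (expr_value x (p k))) = 0" for x s
    by (simp add: G_def interp_expr_sum)
  \<comment> \<open>The combined equations are equivalent to the original ones: \<open>M\<close>
    acts injectively on tuples over the algebra, because the pivot block of the Jacobian undoes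
    it.\<close>
  have M_kernel: "(\<forall>s<r. (\<Sum>k<r. scale (M s k) (v k)) = 0) \<longleftrightarrow> (\<forall>k<r. v k = 0)" for v
  proof
    assume v: "\<forall>s<r. (\<Sum>k<r. scale (M s k) (v k)) = 0"
    show "\<forall>k<r. v k = 0"
    proof (intro allI impI)
      fix k
      assume "k < r"
      then have "v k = (\<Sum>l<r. if k = l then v l else 0)"
        by simp
      \<comment> \<open>The identity matrix is written as the pivot block times \<open>M\<close>;
        exchanging the sums then exposes the vanishing combinations.\<close>
      also have "\<dots> = (\<Sum>l<r. scale (\<Sum>t<r. ?J $$ (k, i t) * M t l) (v l))"
        by (rule sum.cong) (use JM \<open>k < r\<close> in auto)
      also have "\<dots> = (\<Sum>l<r. \<Sum>t<r. scale (?J $$ (k, i t)) (scale (M t l) (v l)))"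
        by (simp add: scale_sum_left)
      also have "\<dots> = (\<Sum>t<r. scale (?J $$ (k, i t)) (\<Sum>l<r. scale (M t l) (v l)))"
        by (subst sum.swap) (simp add: scale_sum_right)
      finally show "v k = 0"
        using v by simp
    qed
  qed simp
  obtain H where vars_H: "\<forall>s<r. vars (H s) \<subseteq> {..<m - r}"
    and H: "\<forall>x. (\<forall>s<r. x (i s) = expr_value x (G s)) \<longleftrightarrow>
      (\<forall>s<r. x (i s) = expr_value (subtuple (m - r) j x) (H s))"
    using polynomial_fixed_point[OF nil split vars_G no_linear] .
  define h where "h s = {(p, q). fp_eq scale mul {..<m - r} p q} `` {H s}" for s
  have h_free: "h s \<in> free_product scale mul {..<m - r}" if "s < r" for s
    unfolding h_def free_product_def using vars_H that by (intro quotientI) simp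
  have value_h: "poly_value scale mul (h s) y = expr_value y (H s)" if "s < r" for s y
    using expr_value_class[OF h_free[OF that]] vars_H that
    by (simp add: h_def fp_eq.refl)
  have solution: "x \<in> solution_set scale mul m r f \<longleftrightarrow>
      (\<forall>s<r. x (i s) = poly_value scale mul (h s) (subtuple (m - r) j x))"
    if "x \<in> direct_power m" for x
  proof -
    have "x \<in> solution_set scale mul m r f \<longleftrightarrow> (\<forall>s<r. expr_value x (p s) = 0)"
      using that by (simp add: solution_set_def value_f)
    also have "\<dots> \<longleftrightarrow> (\<forall>s<r. x (i s) = expr_value x (G s))"
      unfolding value_G M_kernel ..
    also have "\<dots> \<longleftrightarrow> (\<forall>s<r. x (i s) = poly_value scale mul (h s) (subtuple (m - r) j x))"
      unfolding H[rule_format] by (simp add: value_h)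
    finally show ?thesis .
  qed
  have graph: "(\<lambda>x. (subtuple (m - r) j x, subtuple r i x)) ` solution_set scale mul m r f =
      {(y, polynomial_map scale mul r h y) |y. y \<in> direct_power (m - r)}" (is "?L = ?R")
  proof
    show "?L \<subseteq> ?R"
    proof clarify
      fix x
      assume x: "x \<in> solution_set scale mul m r f"
      then have "x \<in> direct_power m"
        by (simp add: solution_set_def)
      then have "subtuple r i x = polynomial_map scale mul r h (subtuple (m - r) j x)"
        using x solution by (auto simp: subtuple_def[of r] polynomial_map_def)
      moreover have "subtuple (m - r) j x \<in> direct_power (m - r)"
        by (simp add: subtuple_def direct_power_def)
      ultimately show "\<exists>y. (subtuple (m - r) j x, subtuple r i x)
          = (y, polynomial_map scale mul r h y) \<and> y \<in> direct_power (m - r)"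
        by blast
    qed
    show "?R \<subseteq> ?L"
    proof clarify
      fix y :: "nat \<Rightarrow> 'a"
      assume "y \<in> direct_power (m - r)"
      \<comment> \<open>The preimage of a point of the graph has free part \<open>y\<close> and the
        values of \<open>h\<close> at \<open>y\<close> as pivots.\<close>
      then obtain x where x: "x \<in> direct_power m" "subtuple (m - r) j x = y"
          "\<And>s. s < r \<Longrightarrow> x (i s) = poly_value scale mul (h s) y"
        using splits_variables_glue[OF split, of y "\<lambda>s. poly_value scale mul (h s) y"] by blast
      then have "x \<in> solution_set scale mul m r f"
        using solution by simp
      moreover have "subtuple r i x = polynomial_map scale mul r h y"
        using x(3) by (auto simp: subtuple_def polynomial_map_def)
      ultimately show "(y, polynomial_map scale mul r h y) \<in> ?L"
        using x(2) by force
    qed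
  qed
  show ?thesis
  proof (intro exI conjI ballI allI impI)
    show "splits_variables m r i j"
      by (rule split)
    show "h s \<in> free_product scale mul {..<m - r}" if "s < r" for s
      using that by (rule h_free)
    show "x \<in> solution_set scale mul m r f \<longleftrightarrow>
        (\<forall>s<r. x (i s) = poly_value scale mul (h s) (subtuple (m - r) j x))"
      if "x \<in> direct_power m" for x
      using that by (rule solution)
    show "vector_space.has_finite_dim (pointwise_scale scale)
        (direct_power (m - r) :: (nat \<Rightarrow> 'a) set) (d * (m - r))"
      if "has_finite_dim UNIV d" for d
      using that by (rule has_finite_dim_direct_power)
  qed (rule graph)
qed

end
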